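(* Let $r>0$, $H>0$ and let $f:[a,b]\to\mathbb{R}$ be of $r$-$H$-Hölder type on $[a,b]$, i.e. $|f(t)-f(s)|\le H|t-s|^r$ for all $t,s\in[a,b]$. Let $g:[a,b]\to\mathbb{R}$ be continuous, let $u:[a,b]\to\mathbb{R}$ be of bounded variation, and let $I_n: a=x_0<x_1<\cdots<x_{n-1}<x_n=b$ be a division of $[a,b]$ such that $u(x_{i+1})\neq u(x_i)$ for $i=0,\dots,n-1$. Then $$\int_a^b f(t)g(t)\,du(t)=S_n(f,g;u,I_n)+R_n(f,g;u,I_n),$$ where $$S_n(f,g;u,I_n):=\sum_{i=0}^{n-1}\frac{1}{u(x_{i+1})-u(x_i)}\int_{x_i}^{x_{i+1}}f(t)\,du(t)\cdot\int_{x_i}^{x_{i+1}}g(t)\,du(t),$$ and the remainder $R_n(f,g;u,I_n)$ satisfies $$\left|R_n(f,g;u,I_n)\right|\le \frac{H}{2^r}\,[v(I_n)]^r\,\max_{0\le i\le n-1}\left\|g-\frac{1}{u(x_{i+1})-u(x_i)}\int_{x_i}^{x_{i+1}}g(s)\,du(s)\right\|_{[x_i,x_{i+1}],\infty}\bigvee_a^b(u),$$ where $v(I_n):=\max_{0\le i\le n-1}(x_{i+1}-x_i)$.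
   Context: All integrals $\int\cdot\,du$ are Riemann–Stieltjes integrals. $\bigvee_a^b(u)$ denotes the total variation of $u$ on $[a,b]$. For a function $h$ on $[c,d]$, $\|h\|_{[c,d],\infty}:=\sup_{t\in[c,d]}|h(t)|$. *)

theory Defs
  imports "HOL-Analysis.Analysis"
begin

(* The points x 0 < ... < x n of a division of [a, b]; values of x beyond n are irrelevant.
   For a < b this forces n >= 1, while n = 0 is the only division of a one-point interval. *)
definition interval_division :: "real \<Rightarrow> real \<Rightarrow> nat \<Rightarrow> (nat \<Rightarrow> real) \<Rightarrow> bool" where
  "interval_division a b n x \<longleftrightarrow> x 0 = a \<and> x n = b \<and> (\<forall>i<n. x i < x (Suc i))"

definition mesh :: "nat \<Rightarrow> (nat \<Rightarrow> real) \<Rightarrow> real" where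
  "mesh n x = (MAX i\<in>{..<n}. x (Suc i) - x i)"

definition variation_sums :: "(real \<Rightarrow> real) \<Rightarrow> real \<Rightarrow> real \<Rightarrow> real set" where
  "variation_sums u a b =
     {(\<Sum>i<n. \<bar>u (x (Suc i)) - u (x i)\<bar>) | n x. interval_division a b n x}"

definition bounded_variation :: "(real \<Rightarrow> real) \<Rightarrow> real \<Rightarrow> real \<Rightarrow> bool" where
  "bounded_variation u a b \<longleftrightarrow> bdd_above (variation_sums u a b)"

definition total_variation :: "(real \<Rightarrow> real) \<Rightarrow> real \<Rightarrow> real \<Rightarrow> real" where
  "total_variation u a b = Sup (variation_sums u a b)"

(* The Riemann-Stieltjes integral as a limit of tagged sums when the mesh tends to 0.
   The mesh condition is written pointwise, so that it also makes sense for n = 0. *)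
definition has_rs_integral ::
    "(real \<Rightarrow> real) \<Rightarrow> (real \<Rightarrow> real) \<Rightarrow> real \<Rightarrow> real \<Rightarrow> real \<Rightarrow> bool" where
  "has_rs_integral f u a b I \<longleftrightarrow>
     (\<forall>e>0. \<exists>d>0. \<forall>n x \<xi>.
        interval_division a b n x \<longrightarrow>
        (\<forall>i<n. x (Suc i) - x i < d) \<longrightarrow>
        (\<forall>i<n. \<xi> i \<in> {x i..x (Suc i)}) \<longrightarrow>
        \<bar>(\<Sum>i<n. f (\<xi> i) * (u (x (Suc i)) - u (x i))) - I\<bar> < e)"

definition rs_integrable :: "(real \<Rightarrow> real) \<Rightarrow> (real \<Rightarrow> real) \<Rightarrow> real \<Rightarrow> real \<Rightarrow> bool" where
  "rs_integrable f u a b \<longleftrightarrow> (\<exists>I. has_rs_integral f u a b I)"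

(* Only meaningful under rs_integrable f u a b. *)
definition rs_integral :: "(real \<Rightarrow> real) \<Rightarrow> (real \<Rightarrow> real) \<Rightarrow> real \<Rightarrow> real \<Rightarrow> real" where
  "rs_integral f u a b = (THE I. has_rs_integral f u a b I)"

definition holder_type :: "real \<Rightarrow> real \<Rightarrow> (real \<Rightarrow> real) \<Rightarrow> real \<Rightarrow> real \<Rightarrow> bool" where
  "holder_type r H f a b \<longleftrightarrow>
     (\<forall>t\<in>{a..b}. \<forall>s\<in>{a..b}. \<bar>f t - f s\<bar> \<le> H * \<bar>t - s\<bar> powr r)"

(* Only meaningful for h bounded on [c, d], since Sup on reals is unspecified otherwise. *)
definition sup_norm :: "(real \<Rightarrow> real) \<Rightarrow> real \<Rightarrow> real \<Rightarrow> real" where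
  "sup_norm h c d = (SUP t\<in>{c..d}. \<bar>h t\<bar>)"

definition rs_mean :: "(real \<Rightarrow> real) \<Rightarrow> (real \<Rightarrow> real) \<Rightarrow> real \<Rightarrow> real \<Rightarrow> real" where
  "rs_mean g u c d = 1 / (u d - u c) * rs_integral g u c d"

definition rs_product_sum ::
    "(real \<Rightarrow> real) \<Rightarrow> (real \<Rightarrow> real) \<Rightarrow> (real \<Rightarrow> real) \<Rightarrow> nat \<Rightarrow> (nat \<Rightarrow> real) \<Rightarrow> real" where
  "rs_product_sum f g u n x =
     (\<Sum>i<n. 1 / (u (x (Suc i)) - u (x i))
        * rs_integral f u (x i) (x (Suc i)) * rs_integral g u (x i) (x (Suc i)))"

end

theory Submission
  imports Defs
begin

text \<open>
  On one cell \<open>[c, d]\<close> of the division let \<open>m\<close> be the mean of \<open>g\<close> with respect to \<open>u\<close>. Because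
  \<open>\<integral> (g - m) du = 0\<close>, the error of the product rule on this cell equals
  \<open>\<integral> (f - f p) (g - m) du\<close> for every point \<open>p\<close>. With \<open>p\<close> the midpoint, the Hoelder condition bounds
  \<open>f - f p\<close> by \<open>H ((d - c) / 2) powr r\<close>, and a Riemann--Stieltjes integral is at most the supremum of
  the modulus of the integrand times the variation of the integrator (\<open>rs_covariance_eq\<close>, \<open>rs_covariance_le\<close>).
  Since the integral is additive over the cells (\<open>rs_integral_sum_division\<close>), summing gives the
  claim.

  Beneath this lies the existence of the integral of a continuous function against a function \<open>u\<close> of
  bounded variation, as a limit over the mesh of the division. The variation enters only through
  the function \<open>T t\<close>, the total variation of \<open>u\<close> on \<open>[a, t]\<close>, whose increments dominate those of
  \<open>u\<close> (\<open>variation_majorant_total_variation\<close>). Two Riemann--Stieltjes sums are compared by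
  distributing the increment of \<open>u\<close> over each cell of one division among the cells of the other
  (\<open>rs_sum_diff_le\<close>); hence the sums over fine divisions form a Cauchy filter and converge
  (\<open>rs_integrable_continuous\<close>). The bounds on the cells then carry the increments of \<open>T\<close>, which
  telescope to the total variation on \<open>[a, b]\<close>.
\<close>

section \<open>Riemann--Stieltjes sums and convergence along fine divisions\<close>

text \<open>
  A division with a choice of tags is packed into one triple \<open>(n, x, \<xi>)\<close>, so that a
  Riemann--Stieltjes sum becomes a function on a single type and its limit a limit along a filter.
\<close>

definition rs_sum ::
    "(real \<Rightarrow> real) \<Rightarrow> (real \<Rightarrow> real) \<Rightarrow> nat \<times> (nat \<Rightarrow> real) \<times> (nat \<Rightarrow> real) \<Rightarrow> real" where
  "rs_sum h u = (\<lambda>(n, x, \<xi>). \<Sum>i<n. h (\<xi> i) * (u (x (Suc i)) - u (x i)))"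

definition fine_divisions ::
    "real \<Rightarrow> real \<Rightarrow> real \<Rightarrow> (nat \<times> (nat \<Rightarrow> real) \<times> (nat \<Rightarrow> real)) set" where
  "fine_divisions a b d =
     {(n, x, \<xi>). interval_division a b n x \<and> (\<forall>i<n. x (Suc i) - x i < d) \<and>
        (\<forall>i<n. \<xi> i \<in> {x i..x (Suc i)})}"

text \<open>
  Stated as a limit along this filter, the integral inherits uniqueness, linearity, bounds and the
  Cauchy criterion from the general theory of \<open>tendsto\<close>.
\<close>

definition fine_filter ::
    "real \<Rightarrow> real \<Rightarrow> (nat \<times> (nat \<Rightarrow> real) \<times> (nat \<Rightarrow> real)) filter" where
  "fine_filter a b = (INF d\<in>{0<..}. principal (fine_divisions a b d))"

lemma fine_divisions_mono: "d \<le> e \<Longrightarrow> fine_divisions a b d \<subseteq> fine_divisions a b e"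
  unfolding fine_divisions_def by fastforce

lemma eventually_fine_filter:
  "eventually P (fine_filter a b) \<longleftrightarrow> (\<exists>d>0. \<forall>D\<in>fine_divisions a b d. P D)"
proof -
  have "eventually P (fine_filter a b) \<longleftrightarrow>
      (\<exists>d\<in>{0<..}. eventually P (principal (fine_divisions a b d)))"
    unfolding fine_filter_def
  proof (rule eventually_INF_base)
    fix d e :: real assume "d \<in> {0<..}" "e \<in> {0<..}"
    then show "\<exists>c\<in>{0<..}. principal (fine_divisions a b c)
        \<le> inf (principal (fine_divisions a b d)) (principal (fine_divisions a b e))"
      by (intro bexI[of _ "min d e"]) (auto intro: fine_divisions_mono[THEN subsetD, rotated])
  qed (auto intro: exI[of _ 1])
  then show ?thesis
    by (auto simp: eventually_principal)
qed

lemma has_rs_integral_iff_tendsto: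
  "has_rs_integral h u a b I \<longleftrightarrow> (rs_sum h u \<longlongrightarrow> I) (fine_filter a b)"
  unfolding has_rs_integral_def tendsto_iff eventually_fine_filter fine_divisions_def
    rs_sum_def dist_real_def Ball_def by (simp add: imp_conjL)

lemma interval_division_mono:
  assumes "interval_division a b n x" "i \<le> j" "j \<le> n"
  shows "x i \<le> x j"
  using assms(2,3)
proof (induction j rule: dec_induct)
  case (step k)
  then have "x i \<le> x k" by simp
  also have "x k < x (Suc k)"
    using assms(1) step.prems by (simp add: interval_division_def)
  finally show ?case by simp
qed simp

lemma interval_division_bounds:
  assumes "interval_division a b n x" "i \<le> n"
  shows "x i \<in> {a..b}"
  using interval_division_mono[OF assms(1), of 0 i] interval_division_mono[OF assms(1), of i n] assms
  by (auto simp: interval_division_def)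

lemma interval_division_tag_in:
  assumes "interval_division a b n x" "i < n" "t \<in> {x i..x (Suc i)}"
  shows "t \<in> {a..b}"
  using interval_division_bounds[OF assms(1), of i] interval_division_bounds[OF assms(1), of "Suc i"]
    assms(2,3) by auto

text \<open>
  Divisions into cells of equal length show that every mesh bound can be met; the one-point
  interval only has the division without cells.
\<close>

lemma fine_filter_neq_bot:
  assumes "a \<le> b"
  shows "fine_filter a b \<noteq> bot"
proof -
  have "fine_divisions a b d \<noteq> {}" if "d > 0" for d
  proof (cases "a = b")
    case True
    then have "(0, \<lambda>_. a, \<lambda>_. a) \<in> fine_divisions a b d"
      by (simp add: fine_divisions_def interval_division_def)
    then show ?thesis by blast
  next
    case False
    with assms have "a < b" by simp
    then have "0 < d / (b - a)" using that by simp
    then obtain n where n: "n > 0" "inverse (real n) < d / (b - a)"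
      using ex_inverse_of_nat_less by blast
    define x where "x i = a + real i * ((b - a) / n)" for i
    have step: "x (Suc i) - x i = (b - a) / n" for i
      by (simp add: x_def distrib_right add_divide_distrib)
    have "0 < (b - a) / n" "(b - a) / n < d"
      using n \<open>a < b\<close> by (auto simp: field_simps)
    then have less: "x i < x (Suc i)" "x (Suc i) - x i < d" for i
      using step[of i] by linarith+
    have "x 0 = a" "x n = b"
      using n by (auto simp: x_def)
    then have "(n, x, x) \<in> fine_divisions a b d"
      using less by (auto simp: fine_divisions_def interval_division_def less_imp_le)
    then show ?thesis by blast
  qed
  then show ?thesis
    by (force simp: trivial_limit_def eventually_fine_filter)
qed

lemma has_rs_integral_unique:
  assumes "a \<le> b" "has_rs_integral h u a b I" "has_rs_integral h u a b J"
  shows "I = J"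
  using assms tendsto_unique[OF fine_filter_neq_bot] by (auto simp: has_rs_integral_iff_tendsto)

lemma rs_integral_eqI:
  assumes "a \<le> b" "has_rs_integral h u a b I"
  shows "rs_integral h u a b = I"
  unfolding rs_integral_def using assms has_rs_integral_unique by blast

lemma rs_integrable_has_rs_integral:
  assumes "a \<le> b" "rs_integrable h u a b"
  shows "has_rs_integral h u a b (rs_integral h u a b)"
  using assms rs_integral_eqI by (metis rs_integrable_def)

lemma has_rs_integral_add:
  assumes "has_rs_integral h u a b I" "has_rs_integral k u a b J"
  shows "has_rs_integral (\<lambda>t. h t + k t) u a b (I + J)"
proof -
  have "rs_sum (\<lambda>t. h t + k t) u = (\<lambda>D. rs_sum h u D + rs_sum k u D)"
    by (auto simp: rs_sum_def distrib_right sum.distrib)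
  then show ?thesis
    using assms by (simp add: has_rs_integral_iff_tendsto tendsto_add)
qed

lemma has_rs_integral_cmult:
  assumes "has_rs_integral h u a b I"
  shows "has_rs_integral (\<lambda>t. c * h t) u a b (c * I)"
proof -
  have "rs_sum (\<lambda>t. c * h t) u = (\<lambda>D. c * rs_sum h u D)"
    by (auto simp: rs_sum_def sum_distrib_left mult.assoc)
  then show ?thesis
    using assms by (simp add: has_rs_integral_iff_tendsto tendsto_mult_left)
qed

lemma has_rs_integral_const: "has_rs_integral (\<lambda>_. c) u a b (c * (u b - u a))"
proof -
  have "rs_sum (\<lambda>_. c) u D = c * (u b - u a)" if "D \<in> fine_divisions a b 1" for D
    using that
    by (auto simp: rs_sum_def fine_divisions_def interval_division_def
        sum_lessThan_telescope[of "\<lambda>i. u (_ i)"] simp flip: sum_distrib_left)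
  then have "eventually (\<lambda>D. rs_sum (\<lambda>_. c) u D = c * (u b - u a)) (fine_filter a b)"
    unfolding eventually_fine_filter by (intro exI[of _ 1]) auto
  then show ?thesis
    by (simp add: has_rs_integral_iff_tendsto tendsto_eventually)
qed

section \<open>Adjacent intervals\<close>

text \<open>
  At position \<open>n\<close> the second division takes over; for adjacent intervals both agree there.
\<close>

definition concat_division ::
    "nat \<times> (nat \<Rightarrow> real) \<times> (nat \<Rightarrow> real) \<Rightarrow> nat \<times> (nat \<Rightarrow> real) \<times> (nat \<Rightarrow> real)
      \<Rightarrow> nat \<times> (nat \<Rightarrow> real) \<times> (nat \<Rightarrow> real)" where
  "concat_division = (\<lambda>(n, x, \<xi>) (m, y, \<eta>).
     (n + m, \<lambda>i. if i < n then x i else y (i - n), \<lambda>i. if i < n then \<xi> i else \<eta> (i - n)))"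

lemma concat_division:
  assumes "D \<in> fine_divisions a b d" "E \<in> fine_divisions b c d"
  shows "concat_division D E \<in> fine_divisions a c d"
    and "rs_sum h u (concat_division D E) = rs_sum h u D + rs_sum h u E"
proof -
  obtain n x \<xi> m y \<eta> where D: "D = (n, x, \<xi>)" and E: "E = (m, y, \<eta>)"
    by (metis surj_pair)
  define z where "z i = (if i < n then x i else y (i - n))" for i
  define \<zeta> where "\<zeta> i = (if i < n then \<xi> i else \<eta> (i - n))" for i
  have cat: "concat_division D E = (n + m, z, \<zeta>)"
    by (simp add: concat_division_def D E z_def[abs_def] \<zeta>_def[abs_def])
  have x: "x 0 = a" "x n = b" "\<And>i. i < n \<Longrightarrow> x i < x (Suc i)" "\<And>i. i < n \<Longrightarrow> x (Suc i) - x i < d"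
      "\<And>i. i < n \<Longrightarrow> \<xi> i \<in> {x i..x (Suc i)}"
    using assms(1) by (auto simp: D fine_divisions_def interval_division_def)
  have y: "y 0 = b" "y m = c" "\<And>i. i < m \<Longrightarrow> y i < y (Suc i)" "\<And>i. i < m \<Longrightarrow> y (Suc i) - y i < d"
      "\<And>i. i < m \<Longrightarrow> \<eta> i \<in> {y i..y (Suc i)}"
    using assms(2) by (auto simp: E fine_divisions_def interval_division_def)
  have left: "z i = x i" if "i \<le> n" for i
    using that x y by (cases "i = n") (auto simp: z_def)
  have right: "z (n + i) = y i" "\<zeta> (n + i) = \<eta> i" for i
    by (auto simp: z_def \<zeta>_def)
  have left_tag: "\<zeta> i = \<xi> i" if "i < n" for i
    using that by (simp add: \<zeta>_def)
  have cells: "z i < z (Suc i) \<and> z (Suc i) - z i < d \<and> \<zeta> i \<in> {z i..z (Suc i)}" if "i < n + m" for i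
  proof (cases "i < n")
    case True
    with x(3-)[of i] show ?thesis by (simp add: left left_tag)
  next
    case False
    then obtain j where j: "i = n + j" by (metis le_iff_add not_less)
    with that have "j < m" by simp
    with y(3-)[of j] show ?thesis
      using right(1)[of "Suc j"] by (simp add: j right)
  qed
  have "z 0 = a" "z (n + m) = c"
    using left[of 0] right(1)[of m] x y by auto
  with cells show "concat_division D E \<in> fine_divisions a c d"
    by (simp add: cat fine_divisions_def interval_division_def)
  have split: "(\<Sum>i<n + k. F i) = (\<Sum>i<n. F i) + (\<Sum>i<k. F (n + i))"
    for F :: "nat \<Rightarrow> real" and k
    by (induction k) auto
  have "rs_sum h u (n + m, z, \<zeta>) = (\<Sum>i<n. h (\<zeta> i) * (u (z (Suc i)) - u (z i)))
      + (\<Sum>i<m. h (\<zeta> (n + i)) * (u (z (Suc (n + i))) - u (z (n + i))))"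
    by (simp add: rs_sum_def split)
  also have "\<dots> = rs_sum h u D + rs_sum h u E"
    using right(1)[of "Suc _"] by (simp add: rs_sum_def D E left left_tag right)
  finally show "rs_sum h u (concat_division D E) = rs_sum h u D + rs_sum h u E"
    by (simp add: cat)
qed

text \<open>
  Concatenating ever finer divisions of the two parts yields ever finer divisions of the whole, so
  the sums over the whole tend to \<open>K\<close> and to \<open>I + J\<close> at once. The existence of \<open>K\<close> has to be
  assumed: it does not follow from that of \<open>I\<close> and \<open>J\<close> when \<open>h\<close> and \<open>u\<close> are both discontinuous
  at \<open>b\<close>, where a cell of the whole may straddle \<open>b\<close>.
\<close>

lemma has_rs_integral_combine:
  assumes "a \<le> b" "b \<le> c"
    and "has_rs_integral h u a b I" "has_rs_integral h u b c J" "has_rs_integral h u a c K"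
  shows "K = I + J"
proof -
  let ?F = "fine_filter a b \<times>\<^sub>F fine_filter b c"
  have "filterlim (\<lambda>(D, E). concat_division D E) (fine_filter a c) ?F"
    unfolding fine_filter_def[of a c] filterlim_INF filterlim_principal
  proof
    fix d :: real assume "d \<in> {0<..}"
    then have "eventually (\<lambda>D. D \<in> fine_divisions a b d) (fine_filter a b)"
        "eventually (\<lambda>E. E \<in> fine_divisions b c d) (fine_filter b c)"
      by (auto simp: eventually_fine_filter)
    then show "\<forall>\<^sub>F p in ?F. (case p of (D, E) \<Rightarrow> concat_division D E) \<in> fine_divisions a c d"
      unfolding eventually_prod_filter using concat_division(1) by fastforce
  qed
  then have "((\<lambda>p. rs_sum h u (case p of (D, E) \<Rightarrow> concat_division D E)) \<longlongrightarrow> K) ?F"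
    using assms(5) unfolding has_rs_integral_iff_tendsto by (rule filterlim_compose[rotated])
  moreover have "\<forall>\<^sub>F p in ?F. rs_sum h u (case p of (D, E) \<Rightarrow> concat_division D E)
      = rs_sum h u (fst p) + rs_sum h u (snd p)"
  proof -
    have "eventually (\<lambda>D. D \<in> fine_divisions a b 1) (fine_filter a b)"
        "eventually (\<lambda>E. E \<in> fine_divisions b c 1) (fine_filter b c)"
      by (auto simp: eventually_fine_filter intro!: exI[of _ 1])
    then show ?thesis
      unfolding eventually_prod_filter using concat_division(2) by fastforce
  qed
  ultimately have "((\<lambda>p. rs_sum h u (fst p) + rs_sum h u (snd p)) \<longlongrightarrow> K) ?F"
    by (rule Lim_transform_eventually)
  moreover have "((\<lambda>p. rs_sum h u (fst p) + rs_sum h u (snd p)) \<longlongrightarrow> I + J) ?F"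
    using assms(3,4) unfolding has_rs_integral_iff_tendsto
    by (intro tendsto_add filterlim_compose[OF _ filterlim_fst] filterlim_compose[OF _ filterlim_snd])
  moreover have "?F \<noteq> bot"
    using assms(1,2) by (simp add: prod_filter_eq_bot fine_filter_neq_bot)
  ultimately show ?thesis
    using tendsto_unique by blast
qed

section \<open>Majorants of the variation\<close>

text \<open>
  A function \<open>T\<close> whose increments dominate those of \<open>u\<close>. All estimates below only use such a \<open>T\<close>:
  its increments telescope along a division, which replaces the additivity of the total variation.
\<close>

definition variation_majorant :: "(real \<Rightarrow> real) \<Rightarrow> (real \<Rightarrow> real) \<Rightarrow> real \<Rightarrow> real \<Rightarrow> bool" where
  "variation_majorant T u a b \<longleftrightarrow>
     (\<forall>s t. a \<le> s \<longrightarrow> s \<le> t \<longrightarrow> t \<le> b \<longrightarrow> \<bar>u t - u s\<bar> \<le> T t - T s)"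

lemma variation_majorantD:
  "variation_majorant T u a b \<Longrightarrow> a \<le> s \<Longrightarrow> s \<le> t \<Longrightarrow> t \<le> b \<Longrightarrow> \<bar>u t - u s\<bar> \<le> T t - T s"
  by (simp add: variation_majorant_def)

lemma variation_majorant_subinterval:
  "variation_majorant T u a b \<Longrightarrow> a \<le> c \<Longrightarrow> d \<le> b \<Longrightarrow> variation_majorant T u c d"
  by (simp add: variation_majorant_def)

lemma variation_majorant_mono:
  "variation_majorant T u a b \<Longrightarrow> a \<le> s \<Longrightarrow> s \<le> t \<Longrightarrow> t \<le> b \<Longrightarrow> T s \<le> T t"
  using variation_majorantD[of T u a b s t] by linarith

text \<open>
  Append \<open>d\<close> to the division of \<open>[a, c]\<close> as one further cell; for \<open>c = d\<close> there is nothing to append,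
  since the points of a division are strictly increasing.
\<close>

lemma variation_sums_append:
  assumes "S \<in> variation_sums u a c" "c \<le> d"
  shows "S + \<bar>u d - u c\<bar> \<in> variation_sums u a d"
proof (cases "c = d")
  case True
  with assms(1) show ?thesis by simp
next
  case False
  obtain n x where S: "S = (\<Sum>i<n. \<bar>u (x (Suc i)) - u (x i)\<bar>)" and x: "interval_division a c n x"
    using assms(1) by (auto simp: variation_sums_def)
  define y where "y = x(Suc n := d)"
  have "interval_division a d (Suc n) y"
    using x False assms(2) by (auto simp: interval_division_def y_def less_Suc_eq)
  moreover have "S + \<bar>u d - u c\<bar> = (\<Sum>i<Suc n. \<bar>u (y (Suc i)) - u (y i)\<bar>)"
    using x by (simp add: S y_def interval_division_def)
  ultimately show ?thesis
    unfolding variation_sums_def by blast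
qed

lemma variation_sums_nonempty:
  assumes "a \<le> b"
  shows "variation_sums u a b \<noteq> {}"
proof -
  have "interval_division a a 0 (\<lambda>_. a)"
    by (simp add: interval_division_def)
  then have "0 \<in> variation_sums u a a"
    unfolding variation_sums_def by (intro CollectI exI[of _ 0] exI[of _ "\<lambda>_. a"]) simp
  then show ?thesis
    using variation_sums_append[OF _ assms] by blast
qed

lemma total_variation_point: "total_variation u a a = 0"
proof -
  have "n = 0" if "interval_division a a n x" for n x
  proof (rule ccontr)
    assume "n \<noteq> 0"
    then have "x 0 < x 1" "x 1 \<le> x n"
      using that interval_division_mono[OF that, of 1 n] by (auto simp: interval_division_def)
    then show False
      using that by (simp add: interval_division_def)
  qed
  then have "variation_sums u a a \<subseteq> {0}"
    by (fastforce simp: variation_sums_def)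
  then have "variation_sums u a a = {0}"
    using variation_sums_nonempty[of a a u] by blast
  then show ?thesis
    by (simp add: total_variation_def)
qed

text \<open>
  Every variation sum over \<open>[a, s]\<close> extends by \<open>\<bar>u t - u s\<bar>\<close> to one over \<open>[a, t]\<close>, and every sum over
  \<open>[a, t]\<close> extends to one over \<open>[a, b]\<close>, so that all the suprema are finite.
\<close>

lemma variation_majorant_total_variation:
  assumes "bounded_variation u a b"
  shows "variation_majorant (total_variation u a) u a b"
  unfolding variation_majorant_def
proof (intro allI impI)
  fix s t assume st: "a \<le> s" "s \<le> t" "t \<le> b"
  obtain B where B: "\<And>S. S \<in> variation_sums u a b \<Longrightarrow> S \<le> B"
    using assms by (auto simp: bounded_variation_def bdd_above_def)
  have "S \<le> B" if "S \<in> variation_sums u a t" for S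
    using B[OF variation_sums_append[OF that st(3)]] by linarith
  then have bdd: "bdd_above (variation_sums u a t)"
    by (auto simp: bdd_above_def)
  have "S \<le> total_variation u a t - \<bar>u t - u s\<bar>" if "S \<in> variation_sums u a s" for S
    using cSup_upper[OF variation_sums_append[OF that st(2)] bdd]
    by (simp add: total_variation_def)
  then have "total_variation u a s \<le> total_variation u a t - \<bar>u t - u s\<bar>"
    unfolding total_variation_def[of u a s]
    using st by (intro cSup_least variation_sums_nonempty) auto
  then show "\<bar>u t - u s\<bar> \<le> total_variation u a t - total_variation u a s"
    by simp
qed

lemma abs_rs_sum_le:
  assumes maj: "variation_majorant T u a b" and D: "D \<in> fine_divisions a b d"
    and bound: "\<And>t. t \<in> {a..b} \<Longrightarrow> \<bar>h t\<bar> \<le> M"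
  shows "\<bar>rs_sum h u D\<bar> \<le> M * (T b - T a)"
proof -
  obtain n x \<xi> where D': "D = (n, x, \<xi>)" and x: "interval_division a b n x"
      and tag: "\<And>i. i < n \<Longrightarrow> \<xi> i \<in> {x i..x (Suc i)}"
    using D by (auto simp: fine_divisions_def)
  have "\<bar>h (\<xi> i) * (u (x (Suc i)) - u (x i))\<bar> \<le> M * (T (x (Suc i)) - T (x i))" if "i < n" for i
  proof -
    have "\<bar>u (x (Suc i)) - u (x i)\<bar> \<le> T (x (Suc i)) - T (x i)"
      using variation_majorantD[OF maj, of "x i" "x (Suc i)"] that
        interval_division_bounds[OF x, of i] interval_division_bounds[OF x, of "Suc i"]
        interval_division_mono[OF x, of i "Suc i"] by simp
    moreover have "\<bar>h (\<xi> i)\<bar> \<le> M"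
      using bound interval_division_tag_in[OF x that tag[OF that]] by blast
    ultimately show ?thesis
      by (auto simp: abs_mult intro!: mult_mono)
  qed
  then have "\<bar>rs_sum h u D\<bar> \<le> (\<Sum>i<n. M * (T (x (Suc i)) - T (x i)))"
    unfolding D' rs_sum_def by (auto intro!: order.trans[OF sum_abs] sum_mono)
  also have "\<dots> = M * (T b - T a)"
    using x sum_lessThan_telescope[of "\<lambda>i. T (x i)" n]
    by (simp add: interval_division_def flip: sum_distrib_left)
  finally show ?thesis .
qed

lemma has_rs_integral_abs_le:
  assumes "a \<le> b" "variation_majorant T u a b" "has_rs_integral h u a b I"
    and "\<And>t. t \<in> {a..b} \<Longrightarrow> \<bar>h t\<bar> \<le> M"
  shows "\<bar>I\<bar> \<le> M * (T b - T a)"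
proof (rule tendsto_upperbound)
  show "((\<lambda>D. \<bar>rs_sum h u D\<bar>) \<longlongrightarrow> \<bar>I\<bar>) (fine_filter a b)"
    using assms(3) by (auto simp: has_rs_integral_iff_tendsto intro: tendsto_rabs)
  show "\<forall>\<^sub>F D in fine_filter a b. \<bar>rs_sum h u D\<bar> \<le> M * (T b - T a)"
    unfolding eventually_fine_filter using abs_rs_sum_le[OF assms(2) _ assms(4)]
    by (intro exI[of _ 1]) auto
qed (rule fine_filter_neq_bot[OF assms(1)])

section \<open>Existence of the integral of a continuous function\<close>

text \<open>
  The increment of \<open>v\<close> over the intersection of \<open>[p, q]\<close> and \<open>[s, t]\<close>: both points \<open>s\<close> and \<open>t\<close> are
  moved to the nearest point of \<open>[p, q]\<close>. When the intervals are disjoint, both land on the same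
  endpoint and the increment vanishes. In this form the sum over the cells \<open>[s, t]\<close> of a division
  telescopes.
\<close>

definition overlap_increment :: "(real \<Rightarrow> real) \<Rightarrow> real \<Rightarrow> real \<Rightarrow> real \<Rightarrow> real \<Rightarrow> real" where
  "overlap_increment v p q s t = v (max p (min t q)) - v (max p (min s q))"

lemma overlap_increment_commute:
  "p \<le> q \<Longrightarrow> s \<le> t \<Longrightarrow> overlap_increment v p q s t = overlap_increment v s t p q"
  unfolding overlap_increment_def max_def min_def by auto

lemma overlap_increment_disjoint:
  "p \<le> q \<Longrightarrow> s \<le> t \<Longrightarrow> q < s \<or> t < p \<Longrightarrow> overlap_increment v p q s t = 0"
  unfolding overlap_increment_def max_def min_def by auto

lemma sum_overlap_increment:
  assumes "interval_division a b m y" "a \<le> p" "p \<le> q" "q \<le> b"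
  shows "(\<Sum>j<m. overlap_increment v p q (y j) (y (Suc j))) = v q - v p"
proof -
  have "(\<Sum>j<m. overlap_increment v p q (y j) (y (Suc j)))
      = v (max p (min (y m) q)) - v (max p (min (y 0) q))"
    unfolding overlap_increment_def
    using sum_lessThan_telescope[of "\<lambda>j. v (max p (min (y j) q))" m] by simp
  also have "\<dots> = v q - v p"
    using assms by (simp add: interval_division_def min_def max_def)
  finally show ?thesis .
qed

lemma abs_overlap_increment_le:
  assumes "variation_majorant T u a b" "a \<le> p" "p \<le> q" "q \<le> b" "s \<le> t"
  shows "\<bar>overlap_increment u p q s t\<bar> \<le> overlap_increment T p q s t"
  unfolding overlap_increment_def
  using assms by (intro variation_majorantD[OF assms(1)]) (auto simp: max_def min_def)

lemma rs_sum_overlap: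
  assumes "interval_division a b n x" "interval_division a b m y"
  shows "rs_sum h u (n, x, \<xi>)
    = (\<Sum>i<n. \<Sum>j<m. h (\<xi> i) * overlap_increment u (x i) (x (Suc i)) (y j) (y (Suc j)))"
proof -
  have "u (x (Suc i)) - u (x i)
      = (\<Sum>j<m. overlap_increment u (x i) (x (Suc i)) (y j) (y (Suc j)))" if "i < n" for i
    using that interval_division_bounds[OF assms(1), of i]
      interval_division_bounds[OF assms(1), of "Suc i"] interval_division_mono[OF assms(1), of i "Suc i"]
    by (intro sum_overlap_increment[OF assms(2), symmetric]) auto
  then show ?thesis
    by (simp add: rs_sum_def flip: sum_distrib_left)
qed

text \<open>
  By \<open>rs_sum_overlap\<close> and the symmetry of overlaps, both sums can be written over all pairs of cells
  with the same weights, the increments of \<open>u\<close> over the overlaps; no common refinement has to be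
  built. The weights of disjoint cells vanish and the remaining ones are dominated by the increments
  of \<open>T\<close>, which add up to \<open>T b - T a\<close>.
\<close>

lemma rs_sum_diff_le:
  assumes maj: "variation_majorant T u a b"
    and D: "D \<in> fine_divisions a b d" and E: "E \<in> fine_divisions a b d"
    and osc: "\<And>s t. s \<in> {a..b} \<Longrightarrow> t \<in> {a..b} \<Longrightarrow> \<bar>s - t\<bar> < 2 * d \<Longrightarrow> \<bar>h s - h t\<bar> \<le> e"
  shows "\<bar>rs_sum h u D - rs_sum h u E\<bar> \<le> e * (T b - T a)"
proof -
  obtain n x \<xi> where D': "D = (n, x, \<xi>)" and x: "interval_division a b n x"
      and fx: "\<And>i. i < n \<Longrightarrow> x (Suc i) - x i < d" and tx: "\<And>i. i < n \<Longrightarrow> \<xi> i \<in> {x i..x (Suc i)}"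
    using D by (auto simp: fine_divisions_def)
  obtain m y \<eta> where E': "E = (m, y, \<eta>)" and y: "interval_division a b m y"
      and fy: "\<And>i. i < m \<Longrightarrow> y (Suc i) - y i < d" and ty: "\<And>i. i < m \<Longrightarrow> \<eta> i \<in> {y i..y (Suc i)}"
    using E by (auto simp: fine_divisions_def)
  define \<Delta> where "\<Delta> v i j = overlap_increment v (x i) (x (Suc i)) (y j) (y (Suc j))" for v i j
  have ux: "x i \<le> x (Suc i)" "a \<le> x i" "x (Suc i) \<le> b" if "i < n" for i
    using that interval_division_bounds[OF x, of i] interval_division_bounds[OF x, of "Suc i"]
      interval_division_mono[OF x, of i "Suc i"] by auto
  have uy: "y j \<le> y (Suc j)" if "j < m" for j
    using that interval_division_mono[OF y, of j "Suc j"] by auto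
  have "rs_sum h u E
      = (\<Sum>j<m. \<Sum>i<n. h (\<eta> j) * overlap_increment u (y j) (y (Suc j)) (x i) (x (Suc i)))"
    unfolding E' by (rule rs_sum_overlap[OF y x])
  also have "\<dots> = (\<Sum>j<m. \<Sum>i<n. h (\<eta> j) * \<Delta> u i j)"
    unfolding \<Delta>_def using ux uy by (intro sum.cong refl) (simp add: overlap_increment_commute)
  also have "\<dots> = (\<Sum>i<n. \<Sum>j<m. h (\<eta> j) * \<Delta> u i j)"
    by (rule sum.swap)
  finally have "rs_sum h u D - rs_sum h u E = (\<Sum>i<n. \<Sum>j<m. (h (\<xi> i) - h (\<eta> j)) * \<Delta> u i j)"
    unfolding D' rs_sum_overlap[OF x y] \<Delta>_def by (simp add: sum_subtractf left_diff_distrib)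
  also have "\<bar>\<dots>\<bar> \<le> (\<Sum>i<n. \<Sum>j<m. \<bar>(h (\<xi> i) - h (\<eta> j)) * \<Delta> u i j\<bar>)"
    by (intro order.trans[OF sum_abs] sum_mono sum_abs)
  also have "\<dots> \<le> (\<Sum>i<n. \<Sum>j<m. e * \<Delta> T i j)"
  proof (intro sum_mono)
    fix i j assume "i \<in> {..<n}" "j \<in> {..<m}"
    then have ij: "i < n" "j < m" by auto
    show "\<bar>(h (\<xi> i) - h (\<eta> j)) * \<Delta> u i j\<bar> \<le> e * \<Delta> T i j"
    proof (cases "x (Suc i) < y j \<or> y (Suc j) < x i")
      case True
      then show ?thesis
        using ux uy ij by (simp add: \<Delta>_def overlap_increment_disjoint)
    next
      case False
      \<comment> \<open>The two cells meet, so their tags are less than two cell lengths apart.\<close>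
      then have "\<bar>\<xi> i - \<eta> j\<bar> < 2 * d"
        using fx[of i] fy[of j] tx[of i] ty[of j] ij by auto
      then have "\<bar>h (\<xi> i) - h (\<eta> j)\<bar> \<le> e"
        using osc ij interval_division_tag_in[OF x _ tx] interval_division_tag_in[OF y _ ty] by blast
      moreover have "\<bar>\<Delta> u i j\<bar> \<le> \<Delta> T i j"
        unfolding \<Delta>_def using ux uy ij by (intro abs_overlap_increment_le[OF maj]) auto
      ultimately show ?thesis
        by (auto simp: abs_mult intro!: mult_mono)
    qed
  qed
  also have "\<dots> = e * (\<Sum>i<n. T (x (Suc i)) - T (x i))"
    unfolding \<Delta>_def using ux by (simp add: sum_overlap_increment[OF y] flip: sum_distrib_left)
  also have "\<dots> = e * (T b - T a)"
    using x sum_lessThan_telescope[of "\<lambda>i. T (x i)" n] by (simp add: interval_division_def)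
  finally show ?thesis .
qed

text \<open>
  Uniform continuity makes the right-hand side of \<open>rs_sum_diff_le\<close> small, so the sums form a Cauchy
  filter.
\<close>

lemma rs_integrable_continuous:
  assumes "a \<le> b" "continuous_on {a..b} h" and maj: "variation_majorant T u a b"
  shows "rs_integrable h u a b"
proof -
  define V where "V = T b - T a"
  have "V \<ge> 0"
    using variation_majorant_mono[OF maj, of a b] assms(1) by (simp add: V_def)
  have "cauchy_filter (filtermap (rs_sum h u) (fine_filter a b))"
    unfolding cauchy_filter_metric_filtermap
  proof (intro allI impI)
    fix e :: real assume "e > 0"
    \<comment> \<open>The summand 1 guards against a vanishing \<open>V\<close>.\<close>
    define e' where "e' = e / (V + 1)"
    have "e' > 0" "e' * V < e"
      using \<open>e > 0\<close> \<open>V \<ge> 0\<close> by (auto simp: e'_def field_simps)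
    have "uniformly_continuous_on {a..b} h"
      using assms(2) by (intro compact_uniformly_continuous) auto
    then obtain d where "d > 0"
      and d: "\<And>s t. s \<in> {a..b} \<Longrightarrow> t \<in> {a..b} \<Longrightarrow> \<bar>s - t\<bar> < d \<Longrightarrow> \<bar>h s - h t\<bar> < e'"
      unfolding uniformly_continuous_on_def dist_real_def using \<open>e' > 0\<close> by metis
    have "\<bar>rs_sum h u D - rs_sum h u E\<bar> < e"
      if "D \<in> fine_divisions a b (d / 2)" "E \<in> fine_divisions a b (d / 2)" for D E
    proof -
      have "\<bar>rs_sum h u D - rs_sum h u E\<bar> \<le> e' * V"
        unfolding V_def by (rule rs_sum_diff_le[OF maj that]) (use d in force)
      with \<open>e' * V < e\<close> show ?thesis by linarith
    qed
    moreover have "eventually (\<lambda>D. D \<in> fine_divisions a b (d / 2)) (fine_filter a b)"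
      unfolding eventually_fine_filter using \<open>d > 0\<close> by (intro exI[of _ "d / 2"]) auto
    ultimately show "\<exists>P. eventually P (fine_filter a b) \<and>
        (\<forall>D E. P D \<and> P E \<longrightarrow> dist (rs_sum h u D) (rs_sum h u E) < e)"
      by (intro exI[of _ "\<lambda>D. D \<in> fine_divisions a b (d / 2)"]) (auto simp: dist_real_def)
  qed
  then obtain I where "filtermap (rs_sum h u) (fine_filter a b) \<le> nhds I"
    using cauchy_filter_complete_converges[OF _ complete_UNIV] fine_filter_neq_bot[OF assms(1)]
    by (metis filtermap_bot_iff principal_UNIV top_greatest)
  then show ?thesis
    by (auto simp: rs_integrable_def has_rs_integral_iff_tendsto filterlim_def)
qed

lemma rs_integral_sum_division:
  assumes cont: "continuous_on {a..b} h" and maj: "variation_majorant T u a b"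
    and x: "interval_division a b n x"
  shows "rs_integral h u a b = (\<Sum>i<n. rs_integral h u (x i) (x (Suc i)))"
proof -
  have has: "has_rs_integral h u c d (rs_integral h u c d)" if "a \<le> c" "c \<le> d" "d \<le> b" for c d
    using that
    by (intro rs_integrable_has_rs_integral rs_integrable_continuous[where T = T]
        continuous_on_subset[OF cont] variation_majorant_subinterval[OF maj]) auto
  have "rs_integral h u a (x k) = (\<Sum>i<k. rs_integral h u (x i) (x (Suc i)))" if "k \<le> n" for k
    using that
  proof (induction k)
    case 0
    have "a \<le> b" using interval_division_mono[OF x, of 0 n] x by (simp add: interval_division_def)
    \<comment> \<open>Splitting the one-point interval into itself twice forces its integral to vanish.\<close>
    then have "rs_integral h u a a = rs_integral h u a a + rs_integral h u a a"
      by (intro has_rs_integral_combine[OF order.refl order.refl has has has]) auto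
    then show ?case
      using x by (simp add: interval_division_def)
  next
    case (Suc k)
    have "rs_integral h u a (x (Suc k)) = rs_integral h u a (x k) + rs_integral h u (x k) (x (Suc k))"
      using Suc.prems interval_division_bounds[OF x, of k] interval_division_bounds[OF x, of "Suc k"]
        interval_division_mono[OF x, of k "Suc k"]
      by (intro has_rs_integral_combine[OF _ _ has has has]) auto
    with Suc show ?case by simp
  qed
  from this[of n] show ?thesis
    using x by (simp add: interval_division_def)
qed

section \<open>The covariance estimate\<close>

lemma holder_type_continuous_on:
  assumes "r > 0" "holder_type r H f a b"
  shows "continuous_on {a..b} f"
  unfolding continuous_on_def
proof
  fix s assume s: "s \<in> {a..b}"
  have "((\<lambda>t. H * \<bar>t - s\<bar> powr r) \<longlongrightarrow> H * \<bar>s - s\<bar> powr r) (at s within {a..b})"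
    using assms(1) by (intro tendsto_intros tendsto_powr') auto
  then have "((\<lambda>t. H * \<bar>t - s\<bar> powr r) \<longlongrightarrow> 0) (at s within {a..b})"
    by simp
  then have "((\<lambda>t. f t - f s) \<longlongrightarrow> 0) (at s within {a..b})"
    by (rule Lim_null_comparison[rotated])
      (use assms(2) s in \<open>auto simp: holder_type_def eventually_at_filter\<close>)
  then show "(f \<longlongrightarrow> f s) (at s within {a..b})"
    by (simp add: LIM_zero_iff)
qed

lemma abs_le_sup_norm:
  assumes "continuous_on {c..d} h" "t \<in> {c..d}"
  shows "\<bar>h t\<bar> \<le> sup_norm h c d"
proof -
  have "compact ((\<lambda>t. \<bar>h t\<bar>) ` {c..d})"
    using assms(1) by (intro compact_continuous_image continuous_intros) auto
  then have "bdd_above ((\<lambda>t. \<bar>h t\<bar>) ` {c..d})"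
    by (simp add: compact_imp_bounded bounded_imp_bdd_above)
  then show ?thesis
    unfolding sup_norm_def using assms(2) by (intro cSUP_upper)
qed

text \<open>
  The error made by replacing \<open>\<integral> f g du\<close> with the normalised product of the integrals is a covariance:
  since \<open>g\<close> minus its mean integrates to zero, any constant \<open>k\<close> may be subtracted from \<open>f\<close>.
\<close>

lemma rs_covariance_eq:
  assumes "c \<le> d" and ne: "u d \<noteq> u c"
    and fg: "rs_integrable (\<lambda>t. f t * g t) u c d"
    and f: "rs_integrable f u c d" and g: "rs_integrable g u c d"
  shows "has_rs_integral (\<lambda>t. (f t - k) * (g t - rs_mean g u c d)) u c d
    (rs_integral (\<lambda>t. f t * g t) u c d
      - 1 / (u d - u c) * rs_integral f u c d * rs_integral g u c d)"
proof -
  let ?m = "rs_mean g u c d"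
  note has = rs_integrable_has_rs_integral[OF \<open>c \<le> d\<close>]
  have "has_rs_integral (\<lambda>t. (f t * g t + (- ?m) * f t) + ((- k) * g t + k * ?m)) u c d
      ((rs_integral (\<lambda>t. f t * g t) u c d + (- ?m) * rs_integral f u c d)
        + ((- k) * rs_integral g u c d + k * ?m * (u d - u c)))"
    by (intro has_rs_integral_add has_rs_integral_cmult has_rs_integral_const has fg f g)
  moreover have "(rs_integral (\<lambda>t. f t * g t) u c d + (- ?m) * rs_integral f u c d)
        + ((- k) * rs_integral g u c d + k * ?m * (u d - u c))
      = rs_integral (\<lambda>t. f t * g t) u c d
        - 1 / (u d - u c) * rs_integral f u c d * rs_integral g u c d"
    using ne by (simp add: rs_mean_def)
  moreover have "(\<lambda>t. (f t * g t + (- ?m) * f t) + ((- k) * g t + k * ?m))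
      = (\<lambda>t. (f t - k) * (g t - ?m))"
    by (simp add: algebra_simps)
  ultimately show ?thesis by (simp only:)
qed

text \<open>
  The constant subtracted from \<open>f\<close> is its value at the midpoint: no point of \<open>[c, d]\<close> is further
  from the midpoint than \<open>(d - c) / 2\<close>, which is the source of the factor \<open>1 / 2 powr r\<close>.
\<close>

lemma rs_covariance_le:
  assumes "c < d" "r > 0" "H > 0" and holder: "holder_type r H f c d"
    and g: "continuous_on {c..d} g" and maj: "variation_majorant T u c d" and ne: "u d \<noteq> u c"
  shows "\<bar>rs_integral (\<lambda>t. f t * g t) u c d
      - 1 / (u d - u c) * rs_integral f u c d * rs_integral g u c d\<bar>
    \<le> H * ((d - c) / 2) powr r * sup_norm (\<lambda>t. g t - rs_mean g u c d) c d * (T d - T c)"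
proof (rule has_rs_integral_abs_le[OF _ maj])
  let ?p = "(c + d) / 2"
  have "c \<le> d" using assms(1) by simp
  have f: "continuous_on {c..d} f"
    by (rule holder_type_continuous_on[OF assms(2) holder])
  note integrable = rs_integrable_continuous[OF \<open>c \<le> d\<close> _ maj]
  show "has_rs_integral (\<lambda>t. (f t - f ?p) * (g t - rs_mean g u c d)) u c d
    (rs_integral (\<lambda>t. f t * g t) u c d
      - 1 / (u d - u c) * rs_integral f u c d * rs_integral g u c d)"
    using \<open>c \<le> d\<close> ne by (rule rs_covariance_eq) (intro integrable continuous_intros f g)+
  fix t assume t: "t \<in> {c..d}"
  then have "\<bar>f t - f ?p\<bar> \<le> H * \<bar>t - ?p\<bar> powr r"
    using holder assms(1) by (simp add: holder_type_def)
  also have "\<dots> \<le> H * ((d - c) / 2) powr r"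
    using assms t by (intro mult_left_mono powr_mono2) (auto simp: abs_le_iff field_simps)
  finally have "\<bar>f t - f ?p\<bar> \<le> H * ((d - c) / 2) powr r" .
  moreover have "\<bar>g t - rs_mean g u c d\<bar> \<le> sup_norm (\<lambda>t. g t - rs_mean g u c d) c d"
    using t by (intro abs_le_sup_norm continuous_intros g)
  ultimately show "\<bar>(f t - f ?p) * (g t - rs_mean g u c d)\<bar>
      \<le> H * ((d - c) / 2) powr r * sup_norm (\<lambda>t. g t - rs_mean g u c d) c d"
    unfolding abs_mult by (intro mult_mono) auto
qed (use assms in auto)

theorem theorem8:
  fixes f g u :: "real \<Rightarrow> real" and a b r H :: real and n :: nat and x :: "nat \<Rightarrow> real"
  assumes "a < b"
    and "r > 0" and "H > 0"
    and "holder_type r H f a b"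
    and "continuous_on {a..b} g"
    and "bounded_variation u a b"
    and "interval_division a b n x"
    and "\<forall>i<n. u (x (Suc i)) \<noteq> u (x i)"
  shows "rs_integrable (\<lambda>t. f t * g t) u a b \<and>
    (\<forall>i<n. rs_integrable f u (x i) (x (Suc i)) \<and> rs_integrable g u (x i) (x (Suc i))) \<and>
    (\<exists>R. rs_integral (\<lambda>t. f t * g t) u a b = rs_product_sum f g u n x + R \<and>
      \<bar>R\<bar> \<le> H / 2 powr r * mesh n x powr r
        * (MAX i\<in>{..<n}. sup_norm (\<lambda>t. g t - rs_mean g u (x i) (x (Suc i))) (x i) (x (Suc i)))
        * total_variation u a b)"
proof -
  \<comment> \<open>\<open>C i\<close> is the error made on the \<open>i\<close>-th cell, and \<open>K\<close> the common factor of all cell bounds.\<close>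
  define T where "T = total_variation u a"
  define G where
    "G i = sup_norm (\<lambda>t. g t - rs_mean g u (x i) (x (Suc i))) (x i) (x (Suc i))" for i
  define C where
    "C i = rs_integral (\<lambda>t. f t * g t) u (x i) (x (Suc i))
       - 1 / (u (x (Suc i)) - u (x i)) * rs_integral f u (x i) (x (Suc i))
         * rs_integral g u (x i) (x (Suc i))" for i
  define K where "K = H / 2 powr r * mesh n x powr r * (MAX i\<in>{..<n}. G i)"
  note x = \<open>interval_division a b n x\<close>
  have maj: "variation_majorant T u a b"
    unfolding T_def by (rule variation_majorant_total_variation) fact
  have f: "continuous_on {a..b} f"
    by (rule holder_type_continuous_on) fact+
  note g = \<open>continuous_on {a..b} g\<close>
  have cell: "a \<le> x i" "x i < x (Suc i)" "x (Suc i) \<le> b" if "i < n" for i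
    using that x interval_division_bounds[OF x, of i] interval_division_bounds[OF x, of "Suc i"]
    by (auto simp: interval_division_def)
  then have sub: "{x i..x (Suc i)} \<subseteq> {a..b}" if "i < n" for i
    using that by force
  have majc: "variation_majorant T u (x i) (x (Suc i))" if "i < n" for i
    using that cell by (intro variation_majorant_subinterval[OF maj])
  have whole: "rs_integrable (\<lambda>t. f t * g t) u a b"
    using \<open>a < b\<close> by (intro rs_integrable_continuous[OF _ _ maj] continuous_intros f g) auto
  have cells: "\<forall>i<n. rs_integrable f u (x i) (x (Suc i)) \<and> rs_integrable g u (x i) (x (Suc i))"
    using cell(2) by (auto intro!: rs_integrable_continuous[OF _ _ majc] less_imp_le
        intro: continuous_on_subset[OF f sub] continuous_on_subset[OF g sub])
  have "rs_integral (\<lambda>t. f t * g t) u a b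
      = (\<Sum>i<n. rs_integral (\<lambda>t. f t * g t) u (x i) (x (Suc i)))"
    by (rule rs_integral_sum_division[OF continuous_on_mult[OF f g] maj x])
  also have "\<dots> = rs_product_sum f g u n x + (\<Sum>i<n. C i)"
    by (simp add: rs_product_sum_def C_def flip: sum.distrib)
  finally have eq: "rs_integral (\<lambda>t. f t * g t) u a b = rs_product_sum f g u n x + (\<Sum>i<n. C i)" .
  have "\<bar>C i\<bar> \<le> K * (T (x (Suc i)) - T (x i))" if "i < n" for i
  proof -
    have "x (Suc i) - x i \<le> mesh n x"
      unfolding mesh_def using that by (intro Max_ge) auto
    then have "((x (Suc i) - x i) / 2) powr r \<le> (mesh n x / 2) powr r"
      using cell[OF that] \<open>r > 0\<close> by (intro powr_mono2) auto
    also have "\<dots> = mesh n x powr r / 2 powr r"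
      by (rule powr_divide)
    finally have len: "H * ((x (Suc i) - x i) / 2) powr r \<le> H / 2 powr r * mesh n x powr r"
      using \<open>H > 0\<close> by (simp add: field_simps)
    \<comment> \<open>A value of the function bounded by \<open>G i\<close> shows that \<open>G i\<close> is nonnegative.\<close>
    have "\<bar>g (x i) - rs_mean g u (x i) (x (Suc i))\<bar> \<le> G i"
      unfolding G_def using cell[OF that]
      by (intro abs_le_sup_norm[where h = "\<lambda>t. g t - rs_mean g u (x i) (x (Suc i))"]
          continuous_intros continuous_on_subset[OF g sub[OF that]]) auto
    then have "0 \<le> G i" by linarith
    have "G i \<le> (MAX i\<in>{..<n}. G i)"
      using that by (intro Max_ge) auto
    with len \<open>0 \<le> G i\<close> have "H * ((x (Suc i) - x i) / 2) powr r * G i \<le> K"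
      unfolding K_def using \<open>H > 0\<close> by (intro mult_mono[OF len]) auto
    moreover have "0 \<le> T (x (Suc i)) - T (x i)"
      using variation_majorant_mono[OF maj, of "x i" "x (Suc i)"] cell[OF that] by simp
    moreover have "\<bar>C i\<bar>
        \<le> H * ((x (Suc i) - x i) / 2) powr r * G i * (T (x (Suc i)) - T (x i))"
      unfolding C_def G_def
    proof (rule rs_covariance_le)
      show "holder_type r H f (x i) (x (Suc i))"
        using \<open>holder_type r H f a b\<close> sub[OF that] by (auto simp: holder_type_def)
      show "continuous_on {x i..x (Suc i)} g"
        by (rule continuous_on_subset[OF g sub[OF that]])
    qed (use that cell majc assms in auto)
    ultimately show ?thesis
      by (meson mult_right_mono order_trans)
  qed
  then have "\<bar>\<Sum>i<n. C i\<bar> \<le> (\<Sum>i<n. K * (T (x (Suc i)) - T (x i)))"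
    by (intro order.trans[OF sum_abs] sum_mono) auto
  also have "\<dots> = K * (T b - T a)"
    using x sum_lessThan_telescope[of "\<lambda>i. T (x i)" n]
    by (simp add: interval_division_def flip: sum_distrib_left)
  also have "\<dots> = K * total_variation u a b"
    by (simp add: T_def total_variation_point)
  finally show ?thesis
    using whole cells eq unfolding K_def G_def by blast
qed

end
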